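(* Let $G$ be a non-trivial connected graph. Then for any non-trivial graph $H$, $$\widetilde{\gamma}_{wcon}(G\circ H)=\begin{cases}\gamma(G), & \text{if } \gamma(H)=1,\\ \gamma_t(G), & \text{otherwise.}\end{cases}$$
   Context: All graphs are simple and undirected; a graph is non-trivial if it has at least two vertices. A set $C\subseteq V(G)$ is a dominating set of $G$ if every vertex of $V(G)\setminus C$ is adjacent in $G$ to some vertex of $C$; the domination number $\gamma(G)$ is the minimum cardinality of a dominating set of $G$. For a graph $G$ with no isolated vertices, a set $S\subseteq V(G)$ is a total dominating set if every vertex of $G$ has at least one neighbor in $S$; the total domination number $\gamma_t(G)$ is the minimum cardinality of a total dominating set of $G$. For a connected graph $G$, an $x$–$y$ geodesic is a shortest $x$–$y$ path in $G$. A set $C\subseteq V(G)$ is weakly convex if for every $x,y\in C$ there is an $x$–$y$ geodesic of $G$ all of whose vertices are in $C$ (so the empty set is vacuously weakly convex). A set $D\subseteq V(G)$ is an outer-weakly convex dominating set of $G$ if it is a dominating set of $G$ and $V(G)\setminus D$ is weakly convex in $G$. The outer-weakly convex domination number $\widetilde{\gamma}_{wcon}(G)$ is the minimum cardinality of an outer-weakly convex dominating set of $G$. The lexicographic product $G\circ H$ has vertex set $V(G)\times V(H)$, with $(g,h)$ and $(g',h')$ adjacent if and only if either $gg'\in E(G)$, or $g=g'$ and $hh'\in E(H)$. *)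

theory Defs
  imports Main
begin

unbundle cardinal_syntax

record 'a ugraph =
  vertices :: "'a set"
  edges :: "'a set set"

definition simple_graph :: "'a ugraph \<Rightarrow> bool" where
  "simple_graph G \<longleftrightarrow> (\<forall>e\<in>edges G. e \<subseteq> vertices G \<and> card e = 2)"

definition nontrivial :: "'a ugraph \<Rightarrow> bool" where
  "nontrivial G \<longleftrightarrow> (\<exists>x\<in>vertices G. \<exists>y\<in>vertices G. x \<noteq> y)"

definition adj :: "'a ugraph \<Rightarrow> 'a \<Rightarrow> 'a \<Rightarrow> bool" where
  "adj G u v \<longleftrightarrow> {u, v} \<in> edges G"

definition is_path :: "'a ugraph \<Rightarrow> 'a \<Rightarrow> 'a \<Rightarrow> 'a list \<Rightarrow> bool" where
  "is_path G x y p \<longleftrightarrow>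
     p \<noteq> [] \<and> hd p = x \<and> last p = y \<and> set p \<subseteq> vertices G \<and> distinct p \<and> successively (adj G) p"

definition connected_graph :: "'a ugraph \<Rightarrow> bool" where
  "connected_graph G \<longleftrightarrow> (\<forall>x\<in>vertices G. \<forall>y\<in>vertices G. \<exists>p. is_path G x y p)"

definition geodesic :: "'a ugraph \<Rightarrow> 'a \<Rightarrow> 'a \<Rightarrow> 'a list \<Rightarrow> bool" where
  "geodesic G x y p \<longleftrightarrow> is_path G x y p \<and> (\<forall>q. is_path G x y q \<longrightarrow> length p \<le> length q)"

definition weakly_convex :: "'a ugraph \<Rightarrow> 'a set \<Rightarrow> bool" where
  "weakly_convex G C \<longleftrightarrow>
     C \<subseteq> vertices G \<and> (\<forall>x\<in>C. \<forall>y\<in>C. \<exists>p. geodesic G x y p \<and> set p \<subseteq> C)"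

definition dominating :: "'a ugraph \<Rightarrow> 'a set \<Rightarrow> bool" where
  "dominating G C \<longleftrightarrow> C \<subseteq> vertices G \<and> (\<forall>v\<in>vertices G - C. \<exists>u\<in>C. adj G v u)"

definition total_dominating :: "'a ugraph \<Rightarrow> 'a set \<Rightarrow> bool" where
  "total_dominating G S \<longleftrightarrow> S \<subseteq> vertices G \<and> (\<forall>v\<in>vertices G. \<exists>u\<in>S. adj G v u)"

definition outer_weakly_convex_dominating :: "'a ugraph \<Rightarrow> 'a set \<Rightarrow> bool" where
  "outer_weakly_convex_dominating G D \<longleftrightarrow> dominating G D \<and> weakly_convex G (vertices G - D)"

definition lex_product :: "'a ugraph \<Rightarrow> 'b ugraph \<Rightarrow> ('a \<times> 'b) ugraph" where
  "lex_product G H =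
     \<lparr> vertices = vertices G \<times> vertices H,
       edges = {{(g, h), (g', h')} | g h g' h'.
                  g \<in> vertices G \<and> g' \<in> vertices G \<and> h \<in> vertices H \<and> h' \<in> vertices H \<and>
                  (adj G g g' \<or> g = g' \<and> adj H h h')} \<rparr>"

(* Graphs may be infinite, so a minimum cardinality is a cardinal (in the sense of the cardinal
   library, where a cardinal is a well-order relation), compared across types by =o. With nat-valued
   card every infinite set would count as 0. Lemma min_card_finite below is the finite case. *)
definition min_card :: "'a set set \<Rightarrow> 'a rel" where
  "min_card F = |SOME A. A \<in> F \<and> (\<forall>B\<in>F. |A| \<le>o |B| )|"

definition domination_number :: "'a ugraph \<Rightarrow> 'a rel" where
  "domination_number G = min_card {C. dominating G C}"

definition total_domination_number :: "'a ugraph \<Rightarrow> 'a rel" where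
  "total_domination_number G = min_card {S. total_dominating G S}"

definition owc_domination_number :: "'a ugraph \<Rightarrow> 'a rel" where
  "owc_domination_number G = min_card {D. outer_weakly_convex_dominating G D}"

lemma min_card_attained:
  assumes "F \<noteq> {}"
  shows "\<exists>A\<in>F. min_card F = |A| \<and> (\<forall>B\<in>F. |A| \<le>o |B| )"
proof -
  have "\<exists>r\<in>card_of ` F. \<forall>r'\<in>card_of ` F. r \<le>o r'"
    using assms by (intro exists_minim_Card_order) (auto simp: card_of_Card_order)
  then have "\<exists>A. A \<in> F \<and> (\<forall>B\<in>F. |A| \<le>o |B| )" by auto
  from someI_ex[OF this] show ?thesis unfolding min_card_def by blast
qed

lemma min_card_finite:
  assumes "A \<in> F" "finite A"
  shows "min_card F =o |{..<(LEAST n. \<exists>B\<in>F. finite B \<and> card B = n)}|"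
proof -
  let ?P = "\<lambda>n. \<exists>B\<in>F. finite B \<and> card B = n"
  obtain C where C: "C \<in> F" "min_card F = |C|" "\<forall>B\<in>F. |C| \<le>o |B|"
    using min_card_attained[of F] assms by blast
  have "|C| \<le>o |A|" using C(3) assms(1) by blast
  then have finC: "finite C" using assms(2) by (rule card_of_ordLeq_finite)
  have "(LEAST n. ?P n) = card C"
  proof (rule Least_equality)
    show "?P (card C)" using C(1) finC by blast
  next
    fix n assume "?P n"
    then obtain B where B: "B \<in> F" "finite B" "card B = n" by blast
    have "|C| \<le>o |B|" using C(3) B(1) by blast
    then obtain f where "inj_on f C" "f ` C \<subseteq> B" unfolding card_of_ordLeq[symmetric] by blast
    then have "card C \<le> card B" using B(2) by (rule card_inj_on_le)
    then show "card C \<le> n" using B(3) by simp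
  qed
  moreover have "\<exists>f. bij_betw f C {..<card C}"
    using finC by (intro finite_same_card_bij) simp_all
  then have "|C| =o |{..<card C}|" unfolding card_of_ordIso .
  ultimately show ?thesis using C(2) by simp
qed

lemma adj_commute: "adj G u v \<longleftrightarrow> adj G v u"
  by (simp add: adj_def insert_commute)

lemma adj_imp_neq:
  assumes "simple_graph G" "adj G u v"
  shows "u \<noteq> v"
  using assms by (auto simp: simple_graph_def adj_def)

lemma edges_lex_product_iff:
  "e \<in> edges (lex_product G H) \<longleftrightarrow>
     (\<exists>g h g' h'. e = {(g, h), (g', h')} \<and>
        g \<in> vertices G \<and> g' \<in> vertices G \<and> h \<in> vertices H \<and> h' \<in> vertices H \<and>
        (adj G g g' \<or> g = g' \<and> adj H h h'))"
  by (simp add: lex_product_def)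

lemma adj_lex_product:
  "adj (lex_product G H) (g, h) (g', h') \<longleftrightarrow>
     g \<in> vertices G \<and> g' \<in> vertices G \<and> h \<in> vertices H \<and> h' \<in> vertices H \<and>
     (adj G g g' \<or> g = g' \<and> adj H h h')" (is "?L \<longleftrightarrow> ?R")
proof
  assume ?L
  then obtain a b a' b' where e: "{(g, h), (g', h')} = {(a, b), (a', b')}"
    and ab: "a \<in> vertices G" "a' \<in> vertices G" "b \<in> vertices H" "b' \<in> vertices H"
      "adj G a a' \<or> a = a' \<and> adj H b b'"
    unfolding adj_def[of "lex_product G H"] edges_lex_product_iff by (elim exE conjE)
  from e consider "g = a" "h = b" "g' = a'" "h' = b'" | "g = a'" "h = b'" "g' = a" "h' = b"
    unfolding doubleton_eq_iff prod.inject by (elim disjE conjE)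
  then show ?R
  proof cases
    case 1
    with ab show ?thesis by simp
  next
    case 2
    with ab show ?thesis using adj_commute[of G a a'] adj_commute[of H b b'] by auto
  qed
next
  assume ?R
  then show ?L
    unfolding adj_def[of "lex_product G H"] edges_lex_product_iff
    by (intro exI[of _ g] exI[of _ h] exI[of _ g'] exI[of _ h'] conjI) simp_all
qed

lemma simple_graph_lex_product:
  assumes "simple_graph G" "simple_graph H"
  shows "simple_graph (lex_product G H)"
  unfolding simple_graph_def
proof
  fix e assume "e \<in> edges (lex_product G H)"
  then obtain g h g' h' where e: "e = {(g, h), (g', h')}"
    "g \<in> vertices G" "g' \<in> vertices G" "h \<in> vertices H" "h' \<in> vertices H"
    "adj G g g' \<or> g = g' \<and> adj H h h'"
    unfolding edges_lex_product_iff by (elim exE conjE)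
  have "(g, h) \<noteq> (g', h')"
    using e(6) adj_imp_neq[OF assms(1)] adj_imp_neq[OF assms(2)] by blast
  then have "card e = 2" using e(1) by simp
  moreover have "e \<subseteq> vertices (lex_product G H)" using e by (simp add: lex_product_def)
  ultimately show "e \<subseteq> vertices (lex_product G H) \<and> card e = 2" by blast
qed

end

theory Submission
  imports Defs
begin

text \<open>
  Removing \<open>C \<times> {h0}\<close> from \<open>G \<circ> H\<close> always leaves a weakly convex set: geodesics between different
  fibres are lifts of geodesics of \<open>G\<close>, and their interior can be routed through a layer other than
  \<open>h0\<close>. So the outer condition is free for sets of this form, and only domination matters. If \<open>h0\<close>
  dominates \<open>H\<close>, then a dominating set \<open>C\<close> of \<open>G\<close> suffices; in general, \<open>C\<close> totally dominating
  suffices. Conversely, dominating sets of \<open>G \<circ> H\<close> project to dominating sets of \<open>G\<close>. If no single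
  vertex dominates \<open>H\<close>, then a fibre over a vertex \<open>g\<close> without neighbours in the projection contains
  at least two elements of the set, and one of them can be traded for a neighbour of \<open>g\<close>.
\<close>

section \<open>Minimum cardinals and domination number one\<close>

lemma vertices_lex_product: "vertices (lex_product G H) = vertices G \<times> vertices H"
  by (simp add: lex_product_def)

text \<open>Reduces each inequality between domination numbers to replacing a single set by one that
  is no larger. \<open>F\<close> has to be non-empty because \<open>min_card {}\<close> is an
  arbitrary choice.\<close>

lemma min_card_mono:
  assumes "F \<noteq> {}" "\<And>B. B \<in> F \<Longrightarrow> \<exists>A\<in>E. |A| \<le>o |B|"
  shows "min_card E \<le>o min_card F"
proof -
  obtain B where B: "B \<in> F" "min_card F = |B|"
    using min_card_attained[OF assms(1)] by blast
  then obtain A where A: "A \<in> E" "|A| \<le>o |B|" using assms(2) by blast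
  then obtain A' where "min_card E = |A'|" "|A'| \<le>o |A|"
    using min_card_attained[of E] by blast
  with A B show ?thesis using ordLeq_transitive by fastforce
qed

lemma card_of_eq_singleton_iff: "|A| =o |{()}| \<longleftrightarrow> (\<exists>a. A = {a})"
proof
  assume "|A| =o |{()}|"
  then obtain f where "bij_betw f A {()}" using card_of_ordIso by blast
  then have "card A = 1" using bij_betw_same_card by fastforce
  then show "\<exists>a. A = {a}" by (rule card_1_singletonE) blast
next
  assume "\<exists>a. A = {a}"
  then obtain a where "A = {a}" by blast
  then have "bij_betw (\<lambda>_. ()) A {()}" by (simp add: bij_betw_def)
  then show "|A| =o |{()}|" using card_of_ordIso by blast
qed

lemma dominating_vertices: "dominating G (vertices G)"
  by (simp add: dominating_def)

text \<open>A dominating singleton bounds the minimum by one; it cannot be zero, since the empty set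
  dominates only the empty graph.\<close>

lemma domination_number_eq_one_iff:
  assumes "vertices H \<noteq> {}"
  shows "domination_number H =o |{()}| \<longleftrightarrow> (\<exists>h. dominating H {h})"
proof -
  obtain A where A: "dominating H A" "domination_number H = |A|"
      "\<And>B. dominating H B \<Longrightarrow> |A| \<le>o |B|"
    using min_card_attained[of "{C. dominating H C}"] dominating_vertices[of H]
    unfolding domination_number_def by blast
  show ?thesis
  proof
    assume "domination_number H =o |{()}|"
    then show "\<exists>h. dominating H {h}" using A card_of_eq_singleton_iff by metis
  next
    assume "\<exists>h. dominating H {h}"
    then obtain h where "dominating H {h}" ..
    then have "|A| \<le>o |{h}|" by (rule A(3))
    then obtain f where f: "inj_on f A" "f ` A \<subseteq> {h}"
      unfolding card_of_ordLeq[symmetric] by blast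
    have "A \<noteq> {}" using A(1) assms by (auto simp: dominating_def)
    then obtain a where "a \<in> A" by blast
    with f have "A = {a}" unfolding inj_on_def by blast
    then show "domination_number H =o |{()}|" using A(2) card_of_eq_singleton_iff by metis
  qed
qed

section \<open>Paths and geodesics in a graph\<close>

text \<open>Allowing repetitions makes this applicable to the projection to \<open>G\<close> of a path of \<open>G \<circ> H\<close>.\<close>
lemma lazy_walk_imp_path:
  assumes "p \<noteq> []" "set p \<subseteq> vertices G" "successively (\<lambda>u v. u = v \<or> adj G u v) p"
  shows "\<exists>q. is_path G (hd p) (last p) q \<and> length q \<le> length p"
  using assms
proof (induction p rule: length_induct)
  case (1 p)
  show ?case
  proof (cases "distinct p")
    case True
    have "successively (adj G) p"
      using "1.prems"(3) True
      by (induction p rule: induct_list012) auto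
    then show ?thesis using "1.prems" True by (auto simp: is_path_def)
  next
    case False
    \<comment> \<open>Cutting out the closed part between two visits to \<open>y\<close> keeps both
      ends and leaves a shorter lazy walk.\<close>
    then obtain xs ys zs y where p: "p = xs @ [y] @ ys @ [y] @ zs"
      using not_distinct_decomp by blast
    let ?p = "xs @ [y] @ zs"
    have "successively (\<lambda>u v. u = v \<or> adj G u v) ?p"
      using "1.prems"(3) unfolding p by (auto simp: successively_append_iff successively_Cons)
    moreover have "length ?p < length p" "?p \<noteq> []" "set ?p \<subseteq> vertices G"
      using "1.prems"(2) by (auto simp: p)
    ultimately obtain q where "is_path G (hd ?p) (last ?p) q" "length q \<le> length ?p"
      using "1.IH" by blast
    moreover have "hd ?p = hd p" "last ?p = last p"
      by (simp_all add: p hd_append)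
    ultimately show ?thesis using \<open>length ?p < length p\<close> by (metis less_imp_le le_trans)
  qed
qed

lemma geodesic_exists:
  assumes "connected_graph G" "x \<in> vertices G" "y \<in> vertices G"
  shows "\<exists>p. geodesic G x y p"
proof -
  obtain p where "is_path G x y p" using assms unfolding connected_graph_def by blast
  then have "is_path G x y (ARG_MIN length p. is_path G x y p)"
    by (rule arg_min_natI)
  then show ?thesis
    unfolding geodesic_def using arg_min_nat_le[of "is_path G x y" _ length] by blast
qed

text \<open>The neighbour is the second vertex of a path to some other vertex.\<close>

lemma neighbour_exists:
  assumes "nontrivial G" "connected_graph G" "x \<in> vertices G"
  shows "\<exists>z\<in>vertices G. adj G x z"
proof -
  obtain y where "y \<in> vertices G" "y \<noteq> x" using assms(1) unfolding nontrivial_def by blast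
  then obtain p where p: "is_path G x y p"
    using assms unfolding connected_graph_def by blast
  with \<open>y \<noteq> x\<close> obtain z q where "p = x # z # q"
    by (cases p rule: remdups_adj.cases) (auto simp: is_path_def)
  with p show ?thesis by (auto simp: is_path_def)
qed

section \<open>Geodesics and weak convexity in the product\<close>

lemma is_path_length_le_2:
  assumes "is_path G x y p" "length p \<le> 2"
  shows "x = y \<or> adj G x y"
  using assms by (cases p rule: remdups_adj.cases) (auto simp: is_path_def)

text \<open>An edge of the product lies in a fibre or projects to an edge of \<open>G\<close>, so a
  path projects to a lazy walk, which shortens to a path.\<close>

lemma path_lex_product_project:
  assumes "is_path (lex_product G H) (x, h) (y, k) q"
  shows "\<exists>p. is_path G x y p \<and> length p \<le> length q"
proof -
  from assms have q: "q \<noteq> []" "hd q = (x, h)" "last q = (y, k)"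
      "set q \<subseteq> vertices G \<times> vertices H" "successively (adj (lex_product G H)) q"
    by (auto simp: is_path_def vertices_lex_product)
  have "successively (\<lambda>u v. u = v \<or> adj G u v) (map fst q)"
    unfolding successively_map
    by (rule successively_mono[OF q(5)]) (auto simp: adj_lex_product)
  with lazy_walk_imp_path[of "map fst q" G] q show ?thesis
    by (force simp: hd_map last_map)
qed

text \<open>Along an edge of \<open>G\<close> the second coordinate may change freely, so the lift
  is a path; by projection no path between its ends is shorter. Keeping the interior in layer
  \<open>l\<close> lets it avoid a deleted layer.\<close>

lemma geodesic_lex_product_lift:
  assumes "geodesic G x y p" "x \<noteq> y"
    and "h \<in> vertices H" "k \<in> vertices H" "l \<in> vertices H"
  shows "geodesic (lex_product G H) (x, h) (y, k)
           (map (\<lambda>v. (v, if v = x then h else if v = y then k else l)) p)"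
proof -
  let ?L = "\<lambda>v. (v, if v = x then h else if v = y then k else l)"
  have p: "p \<noteq> []" "hd p = x" "last p = y" "set p \<subseteq> vertices G" "distinct p" "successively (adj G) p"
    using assms(1) by (auto simp: geodesic_def is_path_def)
  have "successively (adj (lex_product G H)) (map ?L p)"
    unfolding successively_map
    by (rule successively_mono[OF p(6)]) (use p(4) assms in \<open>auto simp: adj_lex_product\<close>)
  moreover have "distinct (map ?L p)"
    using p(5) by (simp add: distinct_map inj_on_def)
  ultimately have "is_path (lex_product G H) (x, h) (y, k) (map ?L p)"
    using p assms(2-5) by (auto simp: is_path_def hd_map last_map vertices_lex_product)
  moreover have "length (map ?L p) \<le> length q" if "is_path (lex_product G H) (x, h) (y, k) q" for q
    using path_lex_product_project[OF that] assms(1)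
    unfolding geodesic_def length_map using le_trans by blast
  ultimately show ?thesis unfolding geodesic_def by blast
qed

text \<open>Every vertex over \<open>z\<close> is adjacent to the whole fibre over \<open>x\<close>,
  so distances inside that fibre are at most two, with a midpoint in any desired layer.\<close>

lemma geodesic_lex_product_fibre:
  assumes "simple_graph G" "adj G x z" "x \<in> vertices G" "z \<in> vertices G"
    and "h \<in> vertices H" "k \<in> vertices H" "l \<in> vertices H"
  shows "\<exists>p. geodesic (lex_product G H) (x, h) (x, k) p \<and> set p \<subseteq> {(x, h), (x, k), (z, l)}"
proof -
  consider "h = k" | "adj H h k" "h \<noteq> k" | "h \<noteq> k" "\<not> adj H h k" by blast
  then show ?thesis
  proof cases
    case 1
    have "geodesic (lex_product G H) (x, h) (x, k) [(x, h)]"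
      using assms 1 by (auto simp: geodesic_def is_path_def vertices_lex_product Suc_le_eq)
    then show ?thesis by fastforce
  next
    case 2
    have "2 \<le> length q" if "is_path (lex_product G H) (x, h) (x, k) q" for q
      using that 2 by (cases q rule: remdups_adj.cases) (auto simp: is_path_def)
    moreover have "is_path (lex_product G H) (x, h) (x, k) [(x, h), (x, k)]"
      using assms 2 by (simp add: is_path_def adj_lex_product vertices_lex_product)
    ultimately have "geodesic (lex_product G H) (x, h) (x, k) [(x, h), (x, k)]"
      by (auto simp: geodesic_def eval_nat_numeral)
    then show ?thesis by fastforce
  next
    case 3
    have "x \<noteq> z" by (rule adj_imp_neq[OF assms(1,2)])
    have "adj G z x" using assms(2) by (simp only: adj_commute[of G z x])
    \<comment> \<open>A loop at \<open>x\<close> would join \<open>(x, h)\<close> to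
      \<open>(x, k)\<close> directly.\<close>
    have "\<not> adj G x x" using adj_imp_neq[OF assms(1)] by blast
    then have "3 \<le> length q" if "is_path (lex_product G H) (x, h) (x, k) q" for q
      using is_path_length_le_2[OF that] 3 by (fastforce simp: adj_lex_product)
    moreover have "is_path (lex_product G H) (x, h) (x, k) [(x, h), (z, l), (x, k)]"
      using assms 3 \<open>x \<noteq> z\<close> \<open>adj G z x\<close>
      by (auto simp: is_path_def adj_lex_product vertices_lex_product)
    ultimately have "geodesic (lex_product G H) (x, h) (x, k) [(x, h), (z, l), (x, k)]"
      by (auto simp: geodesic_def eval_nat_numeral)
    then show ?thesis by fastforce
  qed
qed

lemma weakly_convex_lex_product_Diff_layer:
  assumes "simple_graph G" "nontrivial G" "connected_graph G" "nontrivial H"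
  shows "weakly_convex (lex_product G H) (vertices (lex_product G H) - C \<times> {h0})"
  unfolding weakly_convex_def
proof (intro conjI ballI)
  let ?W = "vertices (lex_product G H) - C \<times> {h0}"
  show "?W \<subseteq> vertices (lex_product G H)" by blast
  fix a b assume a: "a \<in> ?W" and b: "b \<in> ?W"
  obtain x h y k where ab: "a = (x, h)" "b = (y, k)" by fastforce
  have V: "x \<in> vertices G" "y \<in> vertices G" "h \<in> vertices H" "k \<in> vertices H"
    using a b by (auto simp: ab vertices_lex_product)
  \<comment> \<open>Layer \<open>l\<close> is untouched by the deletion, so all vertices of a
    geodesic other than its ends are placed there.\<close>
  obtain l where l: "l \<in> vertices H" "l \<noteq> h0" using assms(4) unfolding nontrivial_def by metis
  show "\<exists>p. geodesic (lex_product G H) a b p \<and> set p \<subseteq> ?W"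
  proof (cases "x = y")
    case True
    obtain z where z: "z \<in> vertices G" "adj G x z"
      using neighbour_exists[OF assms(2,3) V(1)] by blast
    obtain p where "geodesic (lex_product G H) a b p" "set p \<subseteq> {a, b, (z, l)}"
      using geodesic_lex_product_fibre[OF assms(1) z(2) V(1) z(1) V(3,4) l(1)]
      unfolding ab True by blast
    moreover have "(z, l) \<in> ?W" using z l by (simp add: vertices_lex_product)
    ultimately show ?thesis using a b by blast
  next
    case False
    obtain p where p: "geodesic G x y p" using geodesic_exists[OF assms(3) V(1,2)] by blast
    let ?p = "map (\<lambda>v. (v, if v = x then h else if v = y then k else l)) p"
    have "set p \<subseteq> vertices G" using p by (simp add: geodesic_def is_path_def)
    then have "set ?p \<subseteq> ?W" using a b l unfolding ab
      by (auto simp: vertices_lex_product split: if_splits)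
    then show ?thesis
      using geodesic_lex_product_lift[OF p False V(3,4) l(1)] unfolding ab by blast
  qed
qed

section \<open>Domination in the product and in its factors\<close>

lemma dominating_lex_product_of_dominating:
  assumes "dominating G C" "dominating H {h0}"
  shows "dominating (lex_product G H) (C \<times> {h0})"
proof -
  \<comment> \<open>Over \<open>C\<close> the dominator is found in the same fibre through
    \<open>h0\<close>, elsewhere in an adjacent fibre.\<close>
  have "\<exists>u\<in>C \<times> {h0}. adj (lex_product G H) (g, h) u"
    if gh: "g \<in> vertices G" "h \<in> vertices H" "(g, h) \<notin> C \<times> {h0}" for g h
  proof (cases "g \<in> C")
    case True
    with gh assms(2) show ?thesis
      by (auto simp: adj_lex_product dominating_def)
  next
    case False
    then obtain u where "u \<in> C" "adj G g u" using gh assms(1) unfolding dominating_def by blast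
    then show ?thesis using gh assms by (auto simp: adj_lex_product dominating_def)
  qed
  then show ?thesis using assms by (auto simp: dominating_def vertices_lex_product)
qed

text \<open>Even a vertex over \<open>S\<close> has a dominator in an adjacent fibre, so any layer
  serves.\<close>

lemma dominating_lex_product_of_total_dominating:
  assumes "total_dominating G S" "h0 \<in> vertices H"
  shows "dominating (lex_product G H) (S \<times> {h0})"
proof -
  have "\<exists>u\<in>S \<times> {h0}. adj (lex_product G H) (g, h) u"
    if "g \<in> vertices G" "h \<in> vertices H" for g h
    using that assms by (fastforce simp: adj_lex_product total_dominating_def)
  then show ?thesis
    using assms by (auto simp: dominating_def total_dominating_def vertices_lex_product)
qed

text \<open>A fibre that misses \<open>D\<close> can only be dominated from other fibres, hence
  along edges of \<open>G\<close>.\<close>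

lemma dominating_fst_image:
  assumes "dominating (lex_product G H) D" "vertices H \<noteq> {}"
  shows "dominating G (fst ` D)"
  unfolding dominating_def
proof (intro conjI ballI)
  show "fst ` D \<subseteq> vertices G" using assms(1) by (auto simp: dominating_def vertices_lex_product)
  fix g assume g: "g \<in> vertices G - fst ` D"
  obtain h where "h \<in> vertices H" using assms(2) by blast
  moreover have "(g, h) \<notin> D" using g by force
  ultimately obtain u where "u \<in> D" "adj (lex_product G H) (g, h) u"
    using g assms(1) unfolding dominating_def vertices_lex_product by blast
  then show "\<exists>u\<in>fst ` D. adj G g u"
    using g by (cases u) (force simp: adj_lex_product)
qed

text \<open>With no help from adjacent fibres, the part of \<open>D\<close> over \<open>g\<close>
  must dominate its fibre, a copy of \<open>H\<close>.\<close>

lemma dominating_fibre: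
  assumes "dominating (lex_product G H) D" "g \<in> vertices G" "\<And>u. u \<in> fst ` D \<Longrightarrow> \<not> adj G g u"
  shows "dominating H {h. (g, h) \<in> D}"
  unfolding dominating_def
proof (intro conjI ballI)
  show "{h. (g, h) \<in> D} \<subseteq> vertices H" using assms(1) by (auto simp: dominating_def vertices_lex_product)
  fix h assume "h \<in> vertices H - {h. (g, h) \<in> D}"
  then have "(g, h) \<in> vertices (lex_product G H) - D" using assms(2) by (simp add: vertices_lex_product)
  then obtain u where u: "u \<in> D" "adj (lex_product G H) (g, h) u"
    using assms(1) unfolding dominating_def by blast
  then show "\<exists>u\<in>{h. (g, h) \<in> D}. adj H h u"
    using assms(3)[of "fst u"] by (cases u) (force simp: adj_lex_product)
qed

text \<open>The trade is carried out by a modified projection \<open>f\<close>, so the cardinality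
  bound is that of an image and covers infinite \<open>D\<close> too.\<close>

lemma total_dominating_of_dominating_lex_product:
  assumes "nontrivial G" "connected_graph G" "vertices H \<noteq> {}" "\<And>h. \<not> dominating H {h}"
    and "dominating (lex_product G H) D"
  shows "\<exists>S. total_dominating G S \<and> |S| \<le>o |D|"
proof -
  define bad where "bad g \<longleftrightarrow> g \<in> vertices G \<and> (\<forall>u\<in>fst ` D. \<not> adj G g u)" for g
  have "\<exists>h k. (g, h) \<in> D \<and> (g, k) \<in> D \<and> h \<noteq> k" if "bad g" for g
  proof -
    let ?F = "{h. (g, h) \<in> D}"
    have F: "dominating H ?F"
      using dominating_fibre[OF assms(5)] that unfolding bad_def by blast
    with assms(3) obtain h where "h \<in> ?F" by (auto simp: dominating_def)
    moreover have "?F \<noteq> {h}" using F assms(4) by metis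
    ultimately show ?thesis by blast
  qed
  \<comment> \<open>The point \<open>(g, s g)\<close> will be traded for a neighbour of
    \<open>g\<close>, while \<open>(g, t g)\<close> keeps \<open>g\<close> in the image.\<close>
  then obtain s t where st: "\<And>g. bad g \<Longrightarrow> (g, s g) \<in> D" "\<And>g. bad g \<Longrightarrow> (g, t g) \<in> D"
      "\<And>g. bad g \<Longrightarrow> s g \<noteq> t g"
    by metis
  obtain n where n: "\<And>g. g \<in> vertices G \<Longrightarrow> n g \<in> vertices G \<and> adj G g (n g)"
    using neighbour_exists[OF assms(1,2)] by metis
  define f where "f d = (if bad (fst d) \<and> snd d = s (fst d) then n (fst d) else fst d)" for d
  have DV: "fst ` D \<subseteq> vertices G" using assms(5) by (auto simp: dominating_def vertices_lex_product)
  \<comment> \<open>Nothing of the plain projection is lost, so vertices that are not bad keep their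
    neighbours.\<close>
  have fst_in: "fst ` D \<subseteq> f ` D"
  proof
    fix g assume "g \<in> fst ` D"
    then obtain h where h: "(g, h) \<in> D" by force
    have "\<exists>k. (g, k) \<in> D \<and> f (g, k) = g"
    proof (cases "bad g")
      case True
      then show ?thesis using st(2,3)[of g] by (intro exI[of _ "t g"]) (simp add: f_def)
    next
      case False
      then show ?thesis using h by (auto simp: f_def)
    qed
    then show "g \<in> f ` D" by force
  qed
  have "total_dominating G (f ` D)"
    unfolding total_dominating_def
  proof (intro conjI ballI)
    show "f ` D \<subseteq> vertices G" using DV n by (auto simp: f_def)
    fix g assume g: "g \<in> vertices G"
    show "\<exists>u\<in>f ` D. adj G g u"
    proof (cases "bad g")
      case True
      then have "f (g, s g) = n g" "(g, s g) \<in> D" using st(1) by (simp_all add: f_def)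
      then show ?thesis using n[OF g] by (metis imageI)
    next
      case False
      then show ?thesis using g fst_in unfolding bad_def by blast
    qed
  qed
  then show ?thesis using card_of_image by blast
qed

lemma card_of_Times_singleton: "|C \<times> {h}| \<le>o |C|"
proof -
  have "C \<times> {h} = (\<lambda>c. (c, h)) ` C" by blast
  then show ?thesis by (metis card_of_image)
qed

theorem theorem5:
  fixes G :: "'a ugraph" and H :: "'b ugraph"
  assumes "simple_graph G" "nontrivial G" "connected_graph G"
    and "simple_graph H" "nontrivial H"
  shows "owc_domination_number (lex_product G H) =o
    (if domination_number H =o |{()}| then domination_number G else total_domination_number G)"
proof -
  let ?P = "lex_product G H"
  let ?O = "{D. outer_weakly_convex_dominating ?P D}"
  have Hne: "vertices H \<noteq> {}" using assms(5) by (auto simp: nontrivial_def)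
  have layer: "outer_weakly_convex_dominating ?P (C \<times> {h0})" if "dominating ?P (C \<times> {h0})" for C h0
    using that weakly_convex_lex_product_Diff_layer[OF assms(1-3,5)]
    unfolding outer_weakly_convex_dominating_def by blast
  have tot: "total_dominating G (vertices G)"
    using neighbour_exists[OF assms(2,3)] by (auto simp: total_dominating_def)
  obtain h1 where h1: "h1 \<in> vertices H" using Hne by blast
  have "vertices G \<times> {h1} \<in> ?O"
    using layer dominating_lex_product_of_total_dominating[OF tot h1] by blast
  \<comment> \<open>Lower bounds on the minimum over \<open>?O\<close> start from a member attaining
    it.\<close>
  then have One: "?O \<noteq> {}" by blast
  show ?thesis
  proof (cases "domination_number H =o |{()}|")
    case True
    then obtain h0 where h0: "dominating H {h0}"
      using domination_number_eq_one_iff[OF Hne] by blast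
    have "min_card ?O \<le>o min_card {C. dominating G C}"
    proof (rule min_card_mono)
      show "{C. dominating G C} \<noteq> {}" using dominating_vertices by blast
      fix C assume "C \<in> {C. dominating G C}"
      then have "C \<times> {h0} \<in> ?O"
        using layer dominating_lex_product_of_dominating[OF _ h0] by blast
      then show "\<exists>A\<in>?O. |A| \<le>o |C|" by (rule bexI[rotated]) (rule card_of_Times_singleton)
    qed
    moreover have "min_card {C. dominating G C} \<le>o min_card ?O"
    proof (rule min_card_mono[OF One])
      fix D assume "D \<in> ?O"
      then have "dominating G (fst ` D)"
        using dominating_fst_image[OF _ Hne] by (auto simp: outer_weakly_convex_dominating_def)
      then show "\<exists>A\<in>{C. dominating G C}. |A| \<le>o |D|" 
        by (intro bexI[of _ "fst ` D"] card_of_image) simp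
    qed
    ultimately have "min_card ?O =o min_card {C. dominating G C}"
      by (simp only: ordIso_iff_ordLeq simp_thms)
    then show ?thesis
      unfolding if_P[OF True] by (simp only: owc_domination_number_def domination_number_def)
  next
    case False
    then have no: "\<And>h. \<not> dominating H {h}"
      using domination_number_eq_one_iff[OF Hne] by blast
    have "min_card ?O \<le>o min_card {S. total_dominating G S}"
    proof (rule min_card_mono)
      show "{S. total_dominating G S} \<noteq> {}" using tot by blast
      fix S assume "S \<in> {S. total_dominating G S}"
      then have "S \<times> {h1} \<in> ?O"
        using layer dominating_lex_product_of_total_dominating[OF _ h1] by blast
      then show "\<exists>A\<in>?O. |A| \<le>o |S|" by (rule bexI[rotated]) (rule card_of_Times_singleton)
    qed
    moreover have "min_card {S. total_dominating G S} \<le>o min_card ?O"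
    proof (rule min_card_mono[OF One])
      fix D assume "D \<in> ?O"
      then show "\<exists>A\<in>{S. total_dominating G S}. |A| \<le>o |D|"
        using total_dominating_of_dominating_lex_product[OF assms(2,3) Hne no]
        by (auto simp: outer_weakly_convex_dominating_def)
    qed
    ultimately have "min_card ?O =o min_card {S. total_dominating G S}"
      by (simp only: ordIso_iff_ordLeq simp_thms)
    then show ?thesis
      unfolding if_not_P[OF False]
      by (simp only: owc_domination_number_def total_domination_number_def)
  qed
qed

end
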